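(* Let $R$ be a commutative ring, let $r<s$ be positive integers of opposite parity, and let $A,B,D\in R$. Define $(h_m)_{m\in\mathbb{Z}}$ by $h_m=-AB^{k(k+1)/2}D^{k(k-1)/2}$ if $m=k(r+s)-r$ with $k\in\mathbb{Z}$; $h_m=AB^{k(k-1)/2}D^{k(k+1)/2}$ if $m=k(r+s)+r$ with $k\in\mathbb{Z}$; and $h_m=0$ if $m\not\equiv\pm r\pmod{r+s}$. (This sequence is denoted $A\cdot\operatorname{ES}_{r,s}(B,D)$.) Then $h$ is elliptic: for all $a,b,c,d\in\mathbb{Z}$, $$h_{a+b}h_{a-b}h_{c+d}h_{c-d}=h_{a+c}h_{a-c}h_{b+d}h_{b-d}-h_{b+c}h_{b-c}h_{a+d}h_{a-d}.$$ *)

theory Defs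
  imports "HOL-Number_Theory.Cong"
begin

definition elliptic :: "(int \<Rightarrow> 'a::comm_ring_1) \<Rightarrow> bool" where
  "elliptic h \<longleftrightarrow> (\<forall>a b c d.
     h (a + b) * h (a - b) * h (c + d) * h (c - d) =
       h (a + c) * h (a - c) * h (b + d) * h (b - d)
     - h (b + c) * h (b - c) * h (a + d) * h (a - d))"

text \<open>
  The sequence \<open>A \<cdot> ES\<^bsub>r,s\<^esub>(B, D)\<close>. The index \<open>k\<close> with \<open>m = k(r + s) \<mp> r\<close> is recovered by
  exact division. The exponents \<open>k(k \<plusminus> 1)/2\<close> are nonnegative integers for every
  integer \<open>k\<close>, so \<open>nat\<close> truncates nothing. For \<open>0 < r < s\<close> the residues \<open>r\<close> and \<open>-r\<close>
  modulo \<open>r + s\<close> are distinct, so the order of the two tests is irrelevant;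
  \<open>ES_minus\<close>, \<open>ES_plus\<close> and \<open>ES_zero\<close> below are the three defining clauses.
\<close>

definition ES :: "'a::comm_ring_1 \<Rightarrow> int \<Rightarrow> int \<Rightarrow> 'a \<Rightarrow> 'a \<Rightarrow> int \<Rightarrow> 'a" where
  "ES A r s B D m =
     (if [m = - r] (mod (r + s)) then
        (let k = (m + r) div (r + s)
         in - (A * B ^ nat (k * (k + 1) div 2) * D ^ nat (k * (k - 1) div 2)))
      else if [m = r] (mod (r + s)) then
        (let k = (m - r) div (r + s)
         in A * B ^ nat (k * (k - 1) div 2) * D ^ nat (k * (k + 1) div 2))
      else 0)"

lemma ES_minus:
  assumes "0 < r" "r < s"
  shows "ES A r s B D (k * (r + s) - r) =
    - (A * B ^ nat (k * (k + 1) div 2) * D ^ nat (k * (k - 1) div 2))"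
  using assms by (simp add: ES_def cong_iff_dvd_diff)

lemma ES_plus:
  assumes "0 < r" "r < s"
  shows "ES A r s B D (k * (r + s) + r) =
    A * B ^ nat (k * (k - 1) div 2) * D ^ nat (k * (k + 1) div 2)"
proof -
  have "\<not> (r + s) dvd 2 * r"
    using assms zdvd_not_zless[of "2 * r" "r + s"] by simp
  then have "\<not> (r + s) dvd (k * (r + s) + 2 * r)"
    by (metis dvd_add_right_iff dvd_triv_right)
  then have "\<not> [k * (r + s) + r = - r] (mod (r + s))"
    by (simp add: cong_iff_dvd_diff)
  moreover have "[k * (r + s) + r = r] (mod (r + s))"
    by (simp add: cong_iff_dvd_diff)
  ultimately show ?thesis
    using assms by (simp add: ES_def)
qed

lemma ES_zero:
  assumes "\<not> [m = r] (mod (r + s))" "\<not> [m = - r] (mod (r + s))"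
  shows "ES A r s B D m = 0"
  using assms by (simp add: ES_def)

end

theory Submission
  imports Defs
begin

text \<open>
  Let \<open>n = r + s\<close>, which is odd, let \<open>h\<close> be the sequence, and put \<open>p(jn) = (BD)^(j^2)\<close>, with \<open>p\<close>
  vanishing off the multiples of \<open>n\<close>. Then
  \<open>h(a + c) h(a - c) = p(c) h(a)\<^sup>2 - p(a) h(c)\<^sup>2\<close>. Indeed, since 2 is invertible modulo \<open>n\<close>, the
  left side vanishes unless one of \<open>a, c\<close> is \<open>0\<close> and the other \<open>\<plusminus>r\<close> modulo \<open>n\<close>, and in that case the
  exponents match by the parallelogram law for the quadratic form \<open>k(k + 1)/2\<close>. Hence
  \<open>h(a + c) h(a - c)\<close> is an antisymmetric family of \<open>2 \<times> 2\<close> minors, and ellipticity is the Pluecker relation.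
\<close>

text \<open>The quadratic part of \<open>i * (i + 1) div 2\<close> yields the term
  \<open>j\<^sup>2\<close>, and the linear part cancels in \<open>j\<close>. Triangular numbers are
  nonnegative at all integers, so the law passes to the \<open>nat\<close> exponents.\<close>

lemma triangular_parallelogram:
  fixes k j :: int
  shows "nat ((k + j) * (k + j + 1) div 2) + nat ((k - j) * (k - j + 1) div 2) =
    2 * nat (k * (k + 1) div 2) + nat (j\<^sup>2)"
proof -
  define t :: "int \<Rightarrow> int" where "t i = i * (i + 1) div 2" for i
  have two_t: "2 * t i = i * (i + 1)" for i
    unfolding t_def by (rule dvd_mult_div_cancel) simp
  have t_nonneg: "0 \<le> t i" for i
  proof -
    have "0 \<le> i * (i + 1)"
      by (auto simp: zero_le_mult_iff)
    then show ?thesis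
      by (simp add: t_def)
  qed
  have "2 * (t (k + j) + t (k - j)) = 2 * (2 * t k + j\<^sup>2)"
    using two_t[of "k + j"] two_t[of "k - j"] two_t[of k]
    by (simp add: algebra_simps power2_eq_square)
  then have "t (k + j) + t (k - j) = 2 * t k + j\<^sup>2"
    by simp
  then have "nat (t (k + j)) + nat (t (k - j)) = 2 * nat (t k) + nat (j\<^sup>2)"
    using t_nonneg[of "k + j"] t_nonneg[of "k - j"] t_nonneg[of k] zero_le_power2[of j]
    by linarith
  then show ?thesis
    by (simp add: t_def)
qed

lemma residue_cases:
  fixes m n r :: int
  obtains (plus) k where "m = k * n + r" | (minus) k where "m = k * n - r"
    | (neither) "\<not> [m = r] (mod n)" "\<not> [m = - r] (mod n)"
proof -
  have "\<exists>k. m = k * n + r" if "[m = r] (mod n)"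
  proof -
    from that obtain k where "m - r = n * k"
      by (auto simp: cong_iff_dvd_diff elim: dvdE)
    then show ?thesis
      by (intro exI[of _ k]) (simp add: algebra_simps)
  qed
  moreover have "\<exists>k. m = k * n - r" if "[m = - r] (mod n)"
  proof -
    from that obtain k where "m + r = n * k"
      by (auto simp: cong_iff_dvd_diff elim: dvdE)
    then show ?thesis
      by (intro exI[of _ k]) (simp add: algebra_simps)
  qed
  ultimately show ?thesis
    using that by blast
qed

text \<open>Negation swaps the classes of \<open>r\<close> and \<open>- r\<close> and sends
  \<open>k\<close> to \<open>- k\<close>, which exchanges the two triangular exponents.\<close>

lemma ES_uminus:
  assumes "0 < r" "r < s"
  shows "ES A r s B D (- m) = - ES A r s B D m"
proof (cases rule: residue_cases[of m "r + s" r])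
  case (plus k)
  then have "- m = (- k) * (r + s) - r"
    by (simp add: algebra_simps)
  moreover have "(- k) * (- k + 1) = k * (k - 1)" "(- k) * (- k - 1) = k * (k + 1)"
    by (simp_all add: algebra_simps)
  ultimately show ?thesis
    using ES_minus[OF assms, of A B D "- k"] ES_plus[OF assms, of A B D k] plus
    by simp
next
  case (minus k)
  then have "- m = (- k) * (r + s) + r"
    by (simp add: algebra_simps)
  moreover have "(- k) * (- k + 1) = k * (k - 1)" "(- k) * (- k - 1) = k * (k + 1)"
    by (simp_all add: algebra_simps)
  ultimately show ?thesis
    using ES_plus[OF assms, of A B D "- k"] ES_minus[OF assms, of A B D k] minus
    by simp
next
  case neither
  then have "\<not> [- m = r] (mod (r + s))" "\<not> [- m = - r] (mod (r + s))"
    using cong_minus_minus_iff[of m r "r + s"] cong_minus_minus_iff[of m "- r" "r + s"]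
    by simp_all
  with neither show ?thesis
    by (simp add: ES_zero)
qed

text \<open>Both factors stay in the class of \<open>r\<close>, at indices \<open>k + j\<close> and
  \<open>k - j\<close>, so the parallelogram law applies to each exponent and leaves an excess of
  \<open>j\<^sup>2\<close>.\<close>

lemma ES_shift_plus:
  assumes "0 < r" "r < s"
  shows "ES A r s B D (k * (r + s) + r + j * (r + s)) *
      ES A r s B D (k * (r + s) + r - j * (r + s)) =
    (B * D) ^ nat (j\<^sup>2) * (ES A r s B D (k * (r + s) + r))\<^sup>2"
proof -
  let ?t = "\<lambda>i :: int. nat (i * (i + 1) div 2)"
  \<comment> \<open>The exponent of \<open>B\<close> is the triangular number at
    \<open>i - 1\<close>, so one law serves both exponents.\<close>
  have ES: "ES A r s B D (i * (r + s) + r) = A * B ^ ?t (i - 1) * D ^ ?t i" for i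
    using ES_plus[OF assms, of A B D i] by (simp add: mult.commute)
  have shift: "k * (r + s) + r + j * (r + s) = (k + j) * (r + s) + r"
    "k * (r + s) + r - j * (r + s) = (k - j) * (r + s) + r"
    by (simp_all add: algebra_simps)
  have "ES A r s B D (k * (r + s) + r + j * (r + s)) *
      ES A r s B D (k * (r + s) + r - j * (r + s)) =
    A\<^sup>2 * B ^ (?t (k - 1 + j) + ?t (k - 1 - j)) * D ^ (?t (k + j) + ?t (k - j))"
    unfolding shift ES power_add by (simp add: algebra_simps power2_eq_square)
  also have "\<dots> = A\<^sup>2 * B ^ (2 * ?t (k - 1) + nat (j\<^sup>2)) * D ^ (2 * ?t k + nat (j\<^sup>2))"
    by (simp only: triangular_parallelogram)
  also have "\<dots> = (B * D) ^ nat (j\<^sup>2) * (A * B ^ ?t (k - 1) * D ^ ?t k)\<^sup>2"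
    by (simp add: power_add power_mult_distrib power_even_eq ac_simps)
  finally show ?thesis
    unfolding ES .
qed

lemma ES_shift:
  assumes "0 < r" "r < s"
  shows "ES A r s B D (a + j * (r + s)) * ES A r s B D (a - j * (r + s)) =
    (B * D) ^ nat (j\<^sup>2) * (ES A r s B D a)\<^sup>2"
proof (cases rule: residue_cases[of a "r + s" r])
  case (plus k)
  then show ?thesis
    using ES_shift_plus[OF assms] by simp
next
  case (minus k)
  \<comment> \<open>Negation moves \<open>a\<close> into the class of \<open>r\<close>; it swaps the
    two factors, and their signs cancel.\<close>
  then have "- a = - k * (r + s) + r"
    by (simp add: algebra_simps)
  then have "ES A r s B D (- a + j * (r + s)) * ES A r s B D (- a - j * (r + s)) =
      (B * D) ^ nat (j\<^sup>2) * (ES A r s B D (- a))\<^sup>2"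
    by (simp only: ES_shift_plus[OF assms])
  moreover have "ES A r s B D (- a + j * (r + s)) = - ES A r s B D (a - j * (r + s))"
    "ES A r s B D (- a - j * (r + s)) = - ES A r s B D (a + j * (r + s))"
    using ES_uminus[OF assms, of A B D "a - j * (r + s)"]
      ES_uminus[OF assms, of A B D "a + j * (r + s)"] by simp_all
  ultimately show ?thesis
    using ES_uminus[OF assms, of A B D a] by (simp only: minus_mult_minus power2_minus mult.commute)
next
  case neither
  have "[a + j * (r + s) = a] (mod (r + s))"
    by (simp add: cong_iff_dvd_diff)
  with neither have "ES A r s B D (a + j * (r + s)) = 0"
    by (intro ES_zero) (auto simp: cong_def)
  with neither show ?thesis
    by (simp add: ES_zero)
qed

lemma ES_mult_eq_0:
  assumes "odd (r + s)" "\<not> (r + s) dvd a" "\<not> (r + s) dvd c"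
  shows "ES A r s B D (a + c) * ES A r s B D (a - c) = 0"
proof (rule ccontr)
  assume "\<not> ?thesis"
  then have "ES A r s B D (a + c) \<noteq> 0" "ES A r s B D (a - c) \<noteq> 0"
    by auto
  then have "(r + s) dvd (a + c - r) \<or> (r + s) dvd (a + c + r)"
    "(r + s) dvd (a - c - r) \<or> (r + s) dvd (a - c + r)"
    using ES_zero[of "a + c" r s A B D] ES_zero[of "a - c" r s A B D]
    by (auto simp: cong_iff_dvd_diff)
  moreover have "(r + s) dvd 2 * a" if "(r + s) dvd (a + c - e)" "(r + s) dvd (a - c + e)" for e
    using dvd_add[OF that] by simp
  from this[of r] this[of "- r"]
  have "(r + s) dvd 2 * a" if "(r + s) dvd (a + c - r) \<and> (r + s) dvd (a - c + r) \<or>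
    (r + s) dvd (a + c + r) \<and> (r + s) dvd (a - c - r)"
    using that by auto
  moreover have "(r + s) dvd 2 * c" if "(r + s) dvd (a + c - e)" "(r + s) dvd (a - c - e)" for e
    using dvd_diff[OF that] by simp
  from this[of r] this[of "- r"]
  have "(r + s) dvd 2 * c" if "(r + s) dvd (a + c - r) \<and> (r + s) dvd (a - c - r) \<or>
    (r + s) dvd (a + c + r) \<and> (r + s) dvd (a - c + r)"
    using that by auto
  ultimately have "(r + s) dvd 2 * a \<or> (r + s) dvd 2 * c"
    by blast
  moreover have "coprime (r + s) 2"
    using assms(1) by simp
  ultimately show False
    using assms(2,3) by (simp add: coprime_dvd_mult_right_iff)
qed

text \<open>This is the \<open>p\<close> of the introduction, with \<open>x = B * D\<close>. The
  value 0 off the multiples of \<open>n\<close> makes both terms of the minor vanish when neither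
  argument is a multiple.\<close>

definition ES_weight :: "int \<Rightarrow> 'a::comm_ring_1 \<Rightarrow> int \<Rightarrow> 'a" where
  "ES_weight n x a = (if n dvd a then x ^ nat ((a div n)\<^sup>2) else 0)"

lemma ES_multiple_eq_0:
  assumes "0 < r" "r < s" "(r + s) dvd a"
  shows "ES A r s B D a = 0"
proof (rule ES_zero)
  have "\<not> (r + s) dvd r"
    using assms(1,2) zdvd_not_zless[of r "r + s"] by simp
  with assms(3) show "\<not> [a = r] (mod (r + s))" "\<not> [a = - r] (mod (r + s))"
    by (simp_all add: cong_iff_dvd_diff dvd_diff_right_iff dvd_add_right_iff)
qed

lemma ES_mult_eq_minor:
  fixes A B D :: "'a::comm_ring_1" and r s :: int
  assumes "0 < r" "r < s" "odd (r + s)"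
  defines "p \<equiv> ES_weight (r + s) (B * D)"
  shows "ES A r s B D (a + c) * ES A r s B D (a - c) =
    p c * (ES A r s B D a)\<^sup>2 - p a * (ES A r s B D c)\<^sup>2"
proof -
  have multiple: "ES A r s B D (x + y) * ES A r s B D (x - y) = p y * (ES A r s B D x)\<^sup>2"
    if "(r + s) dvd y" for x y
  proof -
    from that obtain j where "y = j * (r + s)"
      by (metis dvdE mult.commute)
    then show ?thesis
      using assms(1,2) ES_shift[OF assms(1,2), of A B D x j] by (simp add: p_def ES_weight_def)
  qed
  \<comment> \<open>In each of the first two cases the shift formula gives one term, and the other
    vanishes because the sequence is zero at multiples of \<open>r + s\<close>.\<close>
  consider "(r + s) dvd c" | "(r + s) dvd a" | "\<not> (r + s) dvd a" "\<not> (r + s) dvd c"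
    by blast
  then show ?thesis
  proof cases
    case 1
    then show ?thesis
      using multiple[OF 1] ES_multiple_eq_0[OF assms(1,2) 1, of A B D] by simp
  next
    case 2
    \<comment> \<open>Oddness exchanges the roles of \<open>a\<close> and \<open>c\<close> at the
      cost of the sign in the minor.\<close>
    have "ES A r s B D (a - c) = - ES A r s B D (c - a)"
      using ES_uminus[OF assms(1,2), of A B D "c - a"] by simp
    then show ?thesis
      using multiple[OF 2, of c] ES_multiple_eq_0[OF assms(1,2) 2, of A B D]
      by (simp add: add.commute)
  next
    case 3
    then show ?thesis
      using ES_mult_eq_0[OF assms(3) 3] by (simp add: p_def ES_weight_def)
  qed
qed

theorem theorem6p1:
  fixes A B D :: "'a::comm_ring_1" and r s :: int
  assumes "0 < r" "r < s" and "even r \<longleftrightarrow> odd s"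
  shows "elliptic (ES A r s B D)"
proof -
  have "odd (r + s)"
    using assms(3) by auto
  note minor = ES_mult_eq_minor[OF assms(1,2) this, of A B D]
  show ?thesis
    \<comment> \<open>Right association exposes the last pair of factors in each product to
      \<open>minor\<close>, left association then the first pair. What remains is the Pluecker
      relation for the matrix with rows \<open>p\<close> and the squares of the sequence.\<close>
    unfolding elliptic_def mult.assoc
    unfolding minor mult.assoc[symmetric]
    unfolding minor
    by (simp add: algebra_simps)
qed

end
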